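(* Let $(M,g)$ be a compact Riemannian manifold of dimension $n\geq 4$, and let $\{e_i\}_{i=1,\dots,n}$ be an orthonormal eigenbasis (at a point) for the Ricci curvature tensor, with corresponding eigenvalues $\lambda_1,\dots,\lambda_n$. Put $\lambda_{ij}=\frac{1}{n-2}\left(\lambda_i+\lambda_j-\frac{1}{n-1}R_g\right)$ and $\mathcal{W}_{ijkl}=\mathcal{W}_g(e_i,e_j,e_k,e_l)$. Then for all $i<j$, $k<l$ the curvature operator $\mathfrak{R}$ satisfies $$\langle\mathfrak{R}(e_i\wedge e_j),e_i\wedge e_j\rangle=\lambda_{ij}+\mathcal{W}_{ijij}=Rm(e_i,e_j,e_i,e_j),$$ $$\langle\mathfrak{R}(e_i\wedge e_j),e_k\wedge e_l\rangle=\mathcal{W}_{ijkl}\quad\text{for all }(i,j)\neq(k,l).$$ Consequently $\mathfrak{R}=\mathfrak{S}+\mathfrak{W}$, where in the basis $\{e_i\wedge e_j\}_{i<j}$ of $\Lambda^2TM$ the operator $\mathfrak{S}$ is the diagonal matrix with diagonal entries $\lambda_{12},\dots,\lambda_{(n-1)n}$, and $\mathfrak{W}$ is the matrix with entries $\mathcal{W}_{ijkl}$ ($i<j$, $k<l$).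
   Context: $Rm$ is the Riemann $(0,4)$ curvature tensor, with sign convention such that $Rm(X,Y,X,Y)$ is the sectional curvature of the plane spanned by orthonormal $X,Y$. $Ric_g$, $R_g$, $\mathcal{W}_g$ are the Ricci tensor, scalar curvature and Weyl tensor. The Schouten tensor is $S_g=\frac{1}{n-2}\left(Ric_g-\frac{R_g}{2(n-1)}g\right)$ and $Rm=S_g\odot g+\mathcal{W}_g$, where for symmetric $(0,2)$-tensors $S,T$ the Kulkarni–Nomizu product is $(S\odot T)(X,Y,Z,W)=S(X,Z)T(Y,W)-S(X,W)T(Y,Z)+S(Y,W)T(X,Z)-S(Y,Z)T(X,W)$. The operators $\mathfrak{R},\mathfrak{S},\mathfrak{W}:\Lambda^2TM\to\Lambda^2TM$ are defined by $g(\mathfrak{R}(X\wedge Y),Z\wedge W)=Rm(X,Y,Z,W)$, $g(\mathfrak{S}(X\wedge Y),Z\wedge W)=(S_g\odot g)(X,Y,Z,W)$, $g(\mathfrak{W}(X\wedge Y),Z\wedge W)=\mathcal{W}_g(X,Y,Z,W)$. The metric on $\Lambda^2TM$ is the one for which $\{e_i\wedge e_j\}_{i<j}$ is orthonormal whenever $\{e_i\}$ is. *)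

theory Defs
  imports "HOL-Analysis.Analysis"
begin

section \<open>Smooth maps on open subsets of Euclidean space\<close>

definition partial :: "'n::finite \<Rightarrow> (real^'n \<Rightarrow> 'b::real_normed_vector) \<Rightarrow> real^'n \<Rightarrow> 'b" where
  "partial i f x = frechet_derivative f (at x) (axis i 1)"

primrec C_on :: "nat \<Rightarrow> (real^'n::finite) set \<Rightarrow> (real^'n \<Rightarrow> 'b::real_normed_vector) \<Rightarrow> bool" where
  "C_on 0 D f \<longleftrightarrow> continuous_on D f"
| "C_on (Suc k) D f \<longleftrightarrow> (\<forall>x\<in>D. f differentiable (at x)) \<and> (\<forall>i. C_on k D (partial i f))"

definition smooth_on :: "(real^'n::finite) set \<Rightarrow> (real^'n \<Rightarrow> 'b::real_normed_vector) \<Rightarrow> bool" where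
  "smooth_on D f \<longleftrightarrow> (\<forall>k. C_on k D f)"


section \<open>Compact Riemannian manifolds\<close>

text \<open>A chart is a pair \<open>(U, \<phi>)\<close>; only the values of \<open>\<phi>\<close> on \<open>U\<close> matter.
  The dimension of the manifold is \<open>CARD('n)\<close>.\<close>

type_synonym ('m, 'n) chart = "'m set \<times> ('m \<Rightarrow> real^'n)"

definition is_chart :: "'m topology \<Rightarrow> ('m, 'n::finite) chart \<Rightarrow> bool" where
  "is_chart M c \<longleftrightarrow> (case c of (U, \<phi>) \<Rightarrow>
     openin M U \<and> open (\<phi> ` U) \<and>
     homeomorphic_map (subtopology M U) (top_of_set (\<phi> ` U)) \<phi>)"

definition transition :: "('m, 'n::finite) chart \<Rightarrow> ('m, 'n) chart \<Rightarrow> real^'n \<Rightarrow> real^'n" where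
  "transition c d = snd d \<circ> inv_into (fst c) (snd c)"

definition smooth_manifold :: "'m topology \<Rightarrow> ('m, 'n::finite) chart set \<Rightarrow> bool" where
  "smooth_manifold M A \<longleftrightarrow>
     Hausdorff_space M \<and> second_countable M \<and>
     (\<forall>c\<in>A. is_chart M c) \<and> (\<Union>c\<in>A. fst c) = topspace M \<and>
     (\<forall>c\<in>A. \<forall>d\<in>A. smooth_on (snd c ` (fst c \<inter> fst d)) (transition c d))"

text \<open>A Riemannian metric is given by its local expressions: \<open>g c x\<close> is the matrix
  \<open>(g\<^sub>i\<^sub>j(x))\<close> with respect to the coordinate frame of the chart \<open>c\<close>.  The last clause is the
  transformation law of a \<open>(0,2)\<close>-tensor field under change of charts.\<close>

definition riemannian_metric ::
    "('m, 'n::finite) chart set \<Rightarrow> (('m, 'n) chart \<Rightarrow> real^'n \<Rightarrow> real^'n^'n) \<Rightarrow> bool" where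
  "riemannian_metric A g \<longleftrightarrow>
     (\<forall>c\<in>A. smooth_on (snd c ` fst c) (g c)) \<and>
     (\<forall>c\<in>A. \<forall>x\<in>snd c ` fst c.
        transpose (g c x) = g c x \<and> (\<forall>X. X \<noteq> 0 \<longrightarrow> X \<bullet> (g c x *v X) > 0)) \<and>
     (\<forall>c\<in>A. \<forall>d\<in>A. \<forall>p\<in>fst c \<inter> fst d. \<forall>X Y.
        X \<bullet> (g c (snd c p) *v Y) =
        frechet_derivative (transition c d) (at (snd c p)) X \<bullet>
          (g d (snd d p) *v frechet_derivative (transition c d) (at (snd c p)) Y))"

definition compact_riemannian_manifold ::
    "'m topology \<Rightarrow> ('m, 'n::finite) chart set \<Rightarrow> (('m, 'n) chart \<Rightarrow> real^'n \<Rightarrow> real^'n^'n) \<Rightarrow> bool" where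
  "compact_riemannian_manifold M A g \<longleftrightarrow>
     smooth_manifold M A \<and> compact_space M \<and> riemannian_metric A g"


section \<open>Curvature\<close>

text \<open>Below, \<open>G\<close> is the local expression of the metric in a chart and \<open>x\<close> is the coordinate vector
  of a point; a tangent vector at that point is given by its components in the coordinate frame.\<close>

definition metric_at :: "(real^'n::finite \<Rightarrow> real^'n^'n) \<Rightarrow> real^'n \<Rightarrow> real^'n \<Rightarrow> real^'n \<Rightarrow> real" where
  "metric_at G x X Y = X \<bullet> (G x *v Y)"

text \<open>\<open>christoffel G m i j x\<close> is the Christoffel symbol \<open>\<Gamma>\<^sup>m\<^sub>i\<^sub>j\<close> of the Levi-Civita connection.\<close>

definition christoffel ::
    "(real^'n::finite \<Rightarrow> real^'n^'n) \<Rightarrow> 'n \<Rightarrow> 'n \<Rightarrow> 'n \<Rightarrow> real^'n \<Rightarrow> real" where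
  "christoffel G m i j x = (1/2) * (\<Sum>l\<in>UNIV. matrix_inv (G x) $ m $ l *
     (partial i (\<lambda>y. G y $ j $ l) x + partial j (\<lambda>y. G y $ i $ l) x - partial l (\<lambda>y. G y $ i $ j) x))"

text \<open>The component of \<open>R(\<partial>\<^sub>i, \<partial>\<^sub>j)\<partial>\<^sub>l\<close> along \<open>\<partial>\<^sub>m\<close>, where
  \<open>R(X,Y)Z = \<nabla>\<^sub>X \<nabla>\<^sub>Y Z - \<nabla>\<^sub>Y \<nabla>\<^sub>X Z - \<nabla>\<^bsub>[X,Y]\<^esub> Z\<close>.\<close>

definition curvature_endo ::
    "(real^'n::finite \<Rightarrow> real^'n^'n) \<Rightarrow> real^'n \<Rightarrow> 'n \<Rightarrow> 'n \<Rightarrow> 'n \<Rightarrow> 'n \<Rightarrow> real" where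
  "curvature_endo G x i j l m =
     partial i (christoffel G m j l) x - partial j (christoffel G m i l) x +
     (\<Sum>s\<in>UNIV. christoffel G m i s x * christoffel G s j l x - christoffel G m j s x * christoffel G s i l x)"

text \<open>\<open>Rm(X,Y,Z,W) = g(R(X,Y)W, Z)\<close>, so that \<open>Rm(X,Y,X,Y) = g(R(X,Y)Y, X)\<close> is the sectional
  curvature for orthonormal \<open>X, Y\<close>.\<close>

definition Rm ::
    "(real^'n::finite \<Rightarrow> real^'n^'n) \<Rightarrow> real^'n \<Rightarrow> real^'n \<Rightarrow> real^'n \<Rightarrow> real^'n \<Rightarrow> real^'n \<Rightarrow> real" where
  "Rm G x X Y Z W = (\<Sum>i\<in>UNIV. \<Sum>j\<in>UNIV. \<Sum>k\<in>UNIV. \<Sum>l\<in>UNIV.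
     (\<Sum>m\<in>UNIV. G x $ k $ m * curvature_endo G x i j l m) * X $ i * Y $ j * Z $ k * W $ l)"

definition Ric :: "(real^'n::finite \<Rightarrow> real^'n^'n) \<Rightarrow> real^'n \<Rightarrow> real^'n \<Rightarrow> real^'n \<Rightarrow> real" where
  "Ric G x Y W = (\<Sum>i\<in>UNIV. \<Sum>k\<in>UNIV. matrix_inv (G x) $ i $ k * Rm G x (axis i 1) Y (axis k 1) W)"

definition scal :: "(real^'n::finite \<Rightarrow> real^'n^'n) \<Rightarrow> real^'n \<Rightarrow> real" where
  "scal G x = (\<Sum>i\<in>UNIV. \<Sum>k\<in>UNIV. matrix_inv (G x) $ i $ k * Ric G x (axis i 1) (axis k 1))"

definition schouten :: "(real^'n::finite \<Rightarrow> real^'n^'n) \<Rightarrow> real^'n \<Rightarrow> real^'n \<Rightarrow> real^'n \<Rightarrow> real" where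
  "schouten G x X Y = 1 / (real CARD('n) - 2) *
     (Ric G x X Y - scal G x / (2 * (real CARD('n) - 1)) * metric_at G x X Y)"

definition kulkarni_nomizu :: "('v \<Rightarrow> 'v \<Rightarrow> real) \<Rightarrow> ('v \<Rightarrow> 'v \<Rightarrow> real) \<Rightarrow> 'v \<Rightarrow> 'v \<Rightarrow> 'v \<Rightarrow> 'v \<Rightarrow> real" where
  "kulkarni_nomizu S T X Y Z W = S X Z * T Y W - S X W * T Y Z + S Y W * T X Z - S Y Z * T X W"

text \<open>The Weyl tensor is the remainder in the decomposition \<open>Rm = S \<odot> g + \<W>\<close>.\<close>

definition weyl ::
    "(real^'n::finite \<Rightarrow> real^'n^'n) \<Rightarrow> real^'n \<Rightarrow> real^'n \<Rightarrow> real^'n \<Rightarrow> real^'n \<Rightarrow> real^'n \<Rightarrow> real" where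
  "weyl G x X Y Z W = Rm G x X Y Z W - kulkarni_nomizu (schouten G x) (metric_at G x) X Y Z W"

definition orthonormal_frame ::
    "(real^'n::finite \<Rightarrow> real^'n^'n) \<Rightarrow> real^'n \<Rightarrow> (nat \<Rightarrow> real^'n) \<Rightarrow> bool" where
  "orthonormal_frame G x e \<longleftrightarrow>
     (\<forall>i\<in>{1..CARD('n)}. \<forall>j\<in>{1..CARD('n)}. metric_at G x (e i) (e j) = (if i = j then 1 else 0))"


section \<open>Bivectors\<close>

lemma transpose_linear:
  fixes A B :: "real^'n^'m"
  shows "transpose (0 :: real^'n^'m) = 0" "transpose (A + B) = transpose A + transpose B"
    "transpose (A - B) = transpose A - transpose B" "transpose (- A) = - transpose A"
    "transpose (r *\<^sub>R A) = r *\<^sub>R transpose A"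
  by (simp_all add: transpose_def vec_eq_iff)

text \<open>The second exterior power of the tangent space at a point, with a bivector given by its
  (antisymmetric) matrix of components \<open>\<omega>\<^sup>i\<^sup>j\<close>.\<close>

typedef (overloaded) 'n bivector = "{A :: real^'n::finite^'n. transpose A = - A}"
  by (rule exI[of _ 0]) (simp add: transpose_def vec_eq_iff)

setup_lifting type_definition_bivector

instantiation bivector :: (finite) real_vector
begin

lift_definition zero_bivector :: "'a bivector" is 0
  by (simp add: transpose_linear)

lift_definition plus_bivector :: "'a bivector \<Rightarrow> 'a bivector \<Rightarrow> 'a bivector" is "(+)"
  by (simp add: transpose_linear)

lift_definition minus_bivector :: "'a bivector \<Rightarrow> 'a bivector \<Rightarrow> 'a bivector" is "(-)"
  by (simp add: transpose_linear)

lift_definition uminus_bivector :: "'a bivector \<Rightarrow> 'a bivector" is uminus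
  by (simp add: transpose_linear)

lift_definition scaleR_bivector :: "real \<Rightarrow> 'a bivector \<Rightarrow> 'a bivector" is scaleR
  by (simp add: transpose_linear)

instance
  by standard (transfer; simp add: algebra_simps)+

end

lift_definition wedge :: "real^'n::finite \<Rightarrow> real^'n \<Rightarrow> 'n bivector"
  is "\<lambda>X Y. \<chi> i j. X $ i * Y $ j - X $ j * Y $ i"
  by (simp add: transpose_def vec_eq_iff)

lift_definition bivector_metric ::
    "(real^'n::finite \<Rightarrow> real^'n^'n) \<Rightarrow> real^'n \<Rightarrow> 'n bivector \<Rightarrow> 'n bivector \<Rightarrow> real"
  is "\<lambda>G x A B. (1/2) * (\<Sum>i\<in>UNIV. \<Sum>j\<in>UNIV. \<Sum>k\<in>UNIV. \<Sum>l\<in>UNIV.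
        G x $ i $ k * G x $ j $ l * A $ i $ j * B $ k $ l)" .

lemma metric_at_eq_sum: "metric_at G x X Y = (\<Sum>i\<in>UNIV. \<Sum>k\<in>UNIV. G x $ i $ k * X $ i * Y $ k)"
  by (simp add: metric_at_def inner_vec_def matrix_vector_mult_def sum_distrib_left ac_simps)

lemma bivector_metric_wedge:
  "bivector_metric G x (wedge X Y) (wedge Z W) =
     metric_at G x X Z * metric_at G x Y W - metric_at G x X W * metric_at G x Y Z"
proof -
  let ?Q = "\<lambda>a b c d. \<Sum>i\<in>UNIV. \<Sum>j\<in>UNIV. \<Sum>k\<in>UNIV. \<Sum>l\<in>UNIV.
     G x $ i $ k * G x $ j $ l * (a $ i * b $ j * c $ k * d $ l)"
  have Q: "?Q a b c d = metric_at G x a c * metric_at G x b d" for a b c d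
  proof -
    have "metric_at G x a c * metric_at G x b d = (\<Sum>i\<in>UNIV. \<Sum>j\<in>UNIV.
        (\<Sum>k\<in>UNIV. G x $ i $ k * a $ i * c $ k) * (\<Sum>l\<in>UNIV. G x $ j $ l * b $ j * d $ l))"
      by (simp add: metric_at_eq_sum sum_product)
    also have "\<dots> = ?Q a b c d"
      unfolding sum_product by (intro sum.cong refl) (simp only: ac_simps)
    finally show ?thesis by simp
  qed
  have "bivector_metric G x (wedge X Y) (wedge Z W) =
      (1/2) * (\<Sum>i\<in>UNIV. \<Sum>j\<in>UNIV. \<Sum>k\<in>UNIV. \<Sum>l\<in>UNIV.
         G x $ i $ k * G x $ j $ l * (X $ i * Y $ j * Z $ k * W $ l) -
         G x $ i $ k * G x $ j $ l * (X $ i * Y $ j * W $ k * Z $ l) -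
         G x $ i $ k * G x $ j $ l * (Y $ i * X $ j * Z $ k * W $ l) +
         G x $ i $ k * G x $ j $ l * (Y $ i * X $ j * W $ k * Z $ l))"
    unfolding bivector_metric.rep_eq wedge.rep_eq vec_lambda_beta
    by (intro arg_cong[where f = "\<lambda>t. (1/2) * t"] sum.cong refl) (simp only: algebra_simps)
  also have "\<dots> = (1/2) * (?Q X Y Z W - ?Q X Y W Z - ?Q Y X Z W + ?Q Y X W Z)"
    by (simp only: sum.distrib sum_subtractf)
  also have "\<dots> = metric_at G x X Z * metric_at G x Y W - metric_at G x X W * metric_at G x Y Z"
    by (simp only: Q) simp
  finally show ?thesis .
qed

text \<open>This determines \<open>bivector_metric\<close>: the bivectors \<open>e\<^sub>i \<and> e\<^sub>j\<close> with \<open>i < j\<close> are orthonormal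
  whenever the vectors \<open>e\<^sub>i\<close> are.\<close>

lemma bivector_metric_orthonormal:
  fixes e :: "nat \<Rightarrow> real^'n::finite"
  assumes "orthonormal_frame G x e"
    and "1 \<le> i" "i < j" "j \<le> CARD('n)" "1 \<le> k" "k < l" "l \<le> CARD('n)"
  shows "bivector_metric G x (wedge (e i) (e j)) (wedge (e k) (e l)) = (if (i, j) = (k, l) then 1 else 0)"
  using assms by (auto simp: bivector_metric_wedge orthonormal_frame_def)

text \<open>The endomorphism of the space of bivectors determined by
  \<open>\<langle>F(X \<and> Y), Z \<and> W\<rangle> = T(X,Y,Z,W)\<close>.\<close>

definition bivector_operator ::
    "(real^'n::finite \<Rightarrow> real^'n^'n) \<Rightarrow> real^'n \<Rightarrow>
     (real^'n \<Rightarrow> real^'n \<Rightarrow> real^'n \<Rightarrow> real^'n \<Rightarrow> real) \<Rightarrow> 'n bivector \<Rightarrow> 'n bivector" where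
  "bivector_operator G x T = (THE F. linear F \<and>
     (\<forall>X Y Z W. bivector_metric G x (F (wedge X Y)) (wedge Z W) = T X Y Z W))"

definition curvature_op :: "(real^'n::finite \<Rightarrow> real^'n^'n) \<Rightarrow> real^'n \<Rightarrow> 'n bivector \<Rightarrow> 'n bivector" where
  "curvature_op G x = bivector_operator G x (Rm G x)"

definition schouten_op :: "(real^'n::finite \<Rightarrow> real^'n^'n) \<Rightarrow> real^'n \<Rightarrow> 'n bivector \<Rightarrow> 'n bivector" where
  "schouten_op G x = bivector_operator G x (kulkarni_nomizu (schouten G x) (metric_at G x))"

definition weyl_op :: "(real^'n::finite \<Rightarrow> real^'n^'n) \<Rightarrow> real^'n \<Rightarrow> 'n bivector \<Rightarrow> 'n bivector" where
  "weyl_op G x = bivector_operator G x (weyl G x)"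

text \<open>\<open>b\<close>, indexed by the finite set \<open>I\<close>, is a basis, and \<open>F\<close> has the matrix \<open>A\<close> (rows first) in it.\<close>

definition has_matrix_in_basis ::
    "('v::real_vector \<Rightarrow> 'v) \<Rightarrow> 'i set \<Rightarrow> ('i \<Rightarrow> 'v) \<Rightarrow> ('i \<Rightarrow> 'i \<Rightarrow> real) \<Rightarrow> bool" where
  "has_matrix_in_basis F I b A \<longleftrightarrow>
     finite I \<and> inj_on b I \<and> independent (b ` I) \<and> span (b ` I) = UNIV \<and>
     linear F \<and> (\<forall>J\<in>I. F (b J) = (\<Sum>K\<in>I. A K J *\<^sub>R b K))"

end

theory Submission
  imports Defs
begin

text \<open>In a chart, lowering the index of the curvature of the Levi-Civita connection gives
  \<open>R\<^sub>i\<^sub>j\<^sub>k\<^sub>l = 1/2 (\<partial>\<^sub>i\<partial>\<^sub>l g\<^sub>j\<^sub>k - \<partial>\<^sub>i\<partial>\<^sub>k g\<^sub>j\<^sub>l - \<partial>\<^sub>j\<partial>\<^sub>l g\<^sub>i\<^sub>k + \<partial>\<^sub>j\<partial>\<^sub>k g\<^sub>i\<^sub>l) - P\<^sub>i\<^sub>k\<^sub>,\<^sub>j\<^sub>l + P\<^sub>j\<^sub>k\<^sub>,\<^sub>i\<^sub>l\<close>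
  with \<open>P\<^sub>a\<^sub>b\<^sub>,\<^sub>c\<^sub>d = g(\<Gamma>\<^sub>a\<^sub>b, \<Gamma>\<^sub>c\<^sub>d)\<close>, from which all symmetries of the curvature tensor can be read off.
  The antisymmetries make the three operators on bivectors well defined, by expansion in an
  orthonormal frame.  In a Ricci eigenframe the Schouten tensor is diagonal, hence so is its
  Kulkarni--Nomizu product with the metric, and the Weyl tensor carries the remaining entries;
  the pair symmetry of \<open>Rm\<close> makes their matrix symmetric, so that rows and columns may be exchanged.\<close>

section \<open>Partial derivatives and inverse matrices\<close>

lemma differentiable_transform_open:
  assumes "f differentiable (at x)" "open D" "x \<in> D" "\<And>y. y \<in> D \<Longrightarrow> f y = h y"
  shows "h differentiable (at x)"
  using assms has_derivative_transform_within_open unfolding differentiable_def by blast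

lemma partial_transform_open:
  assumes "f differentiable (at x)" "open D" "x \<in> D" "\<And>y. y \<in> D \<Longrightarrow> f y = h y"
  shows "partial i f x = partial i h x"
  unfolding partial_def using frechet_derivative_transform_within_open[OF assms] by simp

lemma partial_bounded_linear:
  assumes "bounded_linear L" "f differentiable (at x)"
  shows "partial i (\<lambda>y. L (f y)) x = L (partial i f x)"
proof -
  have "((\<lambda>y. L (f y)) has_derivative (\<lambda>v. L (frechet_derivative f (at x) v))) (at x)"
    using assms bounded_linear.has_derivative frechet_derivative_works by blast
  then show ?thesis
    unfolding partial_def by (simp add: frechet_derivative_at[symmetric])
qed

text \<open>On an open set the derivative at a point depends only on values inside the set, so
  agreement of \<open>f\<close> and \<open>h\<close> passes to their partial derivatives and the
  induction can continue with those.\<close>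

lemma C_on_cong_open:
  assumes "open D" "\<And>y. y \<in> D \<Longrightarrow> f y = h y" "C_on k D f"
  shows "C_on k D h"
  using assms(2,3)
proof (induction k arbitrary: f h)
  case 0
  then show ?case by (simp cong: continuous_on_cong)
next
  case (Suc k)
  have "h differentiable (at y)" if "y \<in> D" for y
    by (rule differentiable_transform_open[OF _ assms(1) that, of f]) (use Suc.prems that in auto)
  moreover have "C_on k D (partial i h)" for i
  proof (rule Suc.IH)
    show "C_on k D (partial i f)"
      using Suc.prems by simp
    show "partial i f y = partial i h y" if "y \<in> D" for y
      by (rule partial_transform_open[OF _ assms(1) that]) (use Suc.prems that in auto)
  qed
  ultimately show ?case by simp
qed

text \<open>Serves to pass from the smooth matrix-valued metric to its entries, each entry being a
  bounded linear function of the matrix.\<close>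

lemma C_on_bounded_linear:
  assumes "bounded_linear L" "open D" "C_on k D f"
  shows "C_on k D (\<lambda>y. L (f y))"
  using assms(3)
proof (induction k arbitrary: f)
  case 0
  then show ?case
    using bounded_linear.continuous_on[OF assms(1)] by simp
next
  case (Suc k)
  have "(\<lambda>y. L (f y)) differentiable (at y)" if "y \<in> D" for y
    using Suc.prems that bounded_linear.has_derivative[OF assms(1)]
    unfolding C_on.simps differentiable_def by blast
  moreover have "C_on k D (partial i (\<lambda>y. L (f y)))" for i
  proof (rule C_on_cong_open[OF assms(2)])
    show "C_on k D (\<lambda>y. L (partial i f y))"
      using Suc by simp
    show "L (partial i f y) = partial i (\<lambda>y. L (f y)) y" if "y \<in> D" for y
      using Suc.prems that by (intro partial_bounded_linear[OF assms(1), symmetric]) simp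
  qed
  ultimately show ?case by simp
qed

lemma smooth_on_bounded_linear:
  "bounded_linear L \<Longrightarrow> open D \<Longrightarrow> smooth_on D f \<Longrightarrow> smooth_on D (\<lambda>y. L (f y))"
  by (simp add: smooth_on_def C_on_bounded_linear)

lemma smooth_on_partial: "smooth_on D f \<Longrightarrow> smooth_on D (partial i f)"
  unfolding smooth_on_def using C_on.simps(2) by blast

lemma smooth_on_differentiable: "smooth_on D f \<Longrightarrow> y \<in> D \<Longrightarrow> f differentiable (at y)"
  unfolding smooth_on_def using C_on.simps(2) by blast

lemma smooth_on_continuous: "smooth_on D f \<Longrightarrow> continuous_on D f"
  unfolding smooth_on_def using C_on.simps(1) by blast

section \<open>Symmetry of mixed second partial derivatives\<close>

lemma DERIV_along_axis:
  fixes f :: "real^'n::finite \<Rightarrow> real"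
  assumes "f differentiable (at (a + s *\<^sub>R axis i 1))"
  shows "((\<lambda>s. f (a + s *\<^sub>R axis i 1)) has_real_derivative partial i f (a + s *\<^sub>R axis i 1)) (at s)"
proof -
  let ?f' = "frechet_derivative f (at (a + s *\<^sub>R axis i 1))"
  have f': "(f has_derivative ?f') (at (a + s *\<^sub>R axis i 1))"
    using assms frechet_derivative_works by blast
  have "((\<lambda>s. f (a + s *\<^sub>R axis i 1)) has_derivative (\<lambda>t. ?f' (t *\<^sub>R axis i 1))) (at s)"
    by (rule has_derivative_compose[where f = "\<lambda>s. a + s *\<^sub>R axis i 1", OF _ f'])
      (auto intro!: derivative_eq_intros)
  moreover have "?f' (t *\<^sub>R axis i 1) = partial i f (a + s *\<^sub>R axis i 1) * t" for t
    unfolding partial_def using linear_cmul[OF has_derivative_linear[OF f']] by simp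
  ultimately show ?thesis
    by (simp add: has_field_derivative_def)
qed

text \<open>The mean value theorem is applied twice, first in direction \<open>i\<close> to the
  difference of \<open>f\<close> across direction \<open>j\<close>, then in direction
  \<open>j\<close> to \<open>partial i f\<close>. The left-hand side is symmetric in
  \<open>i\<close> and \<open>j\<close>, while the right-hand side fixes an order of
  differentiation.\<close>

lemma second_difference_mean_value:
  fixes f :: "real^'n::finite \<Rightarrow> real"
  assumes f: "\<And>y. y \<in> ball x r \<Longrightarrow> f differentiable (at y)"
    and pf: "\<And>y. y \<in> ball x r \<Longrightarrow> partial i f differentiable (at y)"
    and t: "0 < t" "2 * t < r"
  obtains z where "dist x z \<le> 2 * t"
    "f (x + t *\<^sub>R axis i 1 + t *\<^sub>R axis j 1) - f (x + t *\<^sub>R axis i 1) - f (x + t *\<^sub>R axis j 1) + f x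
      = t * t * partial j (partial i f) z"
proof -
  let ?p = "\<lambda>s u. x + s *\<^sub>R axis i 1 + u *\<^sub>R axis j 1 :: real^'n"
  have near: "dist x (?p s u) \<le> 2 * t" if "0 \<le> s" "s \<le> t" "0 \<le> u" "u \<le> t" for s u
  proof -
    have "dist x (?p s u) = norm (s *\<^sub>R axis i 1 + u *\<^sub>R axis j 1 :: real^'n)"
      by (simp add: dist_norm norm_minus_commute algebra_simps)
    also have "\<dots> \<le> s + u"
      using norm_triangle_ineq[of "s *\<^sub>R axis i 1 :: real^'n" "u *\<^sub>R axis j 1"] that by simp
    finally show ?thesis using that by simp
  qed
  have in_ball: "?p s u \<in> ball x r" if "0 \<le> s" "s \<le> t" "0 \<le> u" "u \<le> t" for s u
    using near[OF that] t by simp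
  have swap: "?p s u = x + u *\<^sub>R axis j 1 + s *\<^sub>R axis i 1" for s u
    by (simp add: algebra_simps)
  have D1: "((\<lambda>s. f (?p s u)) has_real_derivative partial i f (?p s u)) (at s)"
    if "0 \<le> s" "s \<le> t" "0 \<le> u" "u \<le> t" for s u
    using DERIV_along_axis[of f "x + u *\<^sub>R axis j 1" s i] f[OF in_ball[OF that]]
    unfolding swap by simp
  obtain s where s: "0 < s" "s < t"
    and eq1: "(f (?p t t) - f (?p t 0)) - (f (?p 0 t) - f (?p 0 0)) =
      (t - 0) * (partial i f (?p s t) - partial i f (?p s 0))"
  proof -
    have "((\<lambda>s. f (?p s t) - f (?p s 0)) has_real_derivative
        partial i f (?p s t) - partial i f (?p s 0)) (at s)" if "0 \<le> s" "s \<le> t" for s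
      using that t by (intro DERIV_diff D1) simp_all
    from MVT2[OF t(1) this] show ?thesis using that by blast
  qed
  have D2: "((\<lambda>u. partial i f (?p s u)) has_real_derivative partial j (partial i f) (?p s u)) (at u)"
    if "0 \<le> u" "u \<le> t" for u
    using DERIV_along_axis[of "partial i f" "x + s *\<^sub>R axis i 1" u j] pf[OF in_ball, of s u] s that
    by simp
  obtain u where u: "0 < u" "u < t"
    and eq2: "partial i f (?p s t) - partial i f (?p s 0) = (t - 0) * partial j (partial i f) (?p s u)"
    using MVT2[of 0 t "\<lambda>u. partial i f (?p s u)" "\<lambda>u. partial j (partial i f) (?p s u)"] t D2
    by auto
  show ?thesis
  proof (rule that)
    show "dist x (?p s u) \<le> 2 * t" using near s u by simp
    show "f (x + t *\<^sub>R axis i 1 + t *\<^sub>R axis j 1) - f (x + t *\<^sub>R axis i 1) - f (x + t *\<^sub>R axis j 1) + f x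
      = t * t * partial j (partial i f) (?p s u)"
      using eq1 eq2 by (simp add: algebra_simps)
  qed
qed

text \<open>Schwarz's theorem: the symmetric second difference equates the two mixed derivatives at
  two points \<open>z\<close> and \<open>w\<close> near \<open>x\<close>, and continuity at
  \<open>x\<close> forces them to agree there.\<close>

lemma partial_commute:
  fixes f :: "real^'n::finite \<Rightarrow> real"
  assumes "open D" "x \<in> D" "smooth_on D f"
  shows "partial i (partial j f) x = partial j (partial i f) x"
proof (rule ccontr)
  assume ne: "partial i (partial j f) x \<noteq> partial j (partial i f) x"
  \<comment> \<open>Half the supposed gap: two values that coincide cannot both lie within
    \<epsilon> of their respective limits.\<close>
  define \<epsilon> where "\<epsilon> = \<bar>partial i (partial j f) x - partial j (partial i f) x\<bar> / 2"
  have \<epsilon>: "\<epsilon> > 0" using ne by (simp add: \<epsilon>_def)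
  have cont: "isCont (partial k (partial l f)) x" for k l
    using assms smooth_on_partial smooth_on_continuous continuous_on_eq_continuous_at by blast
  obtain r where r: "r > 0" "ball x r \<subseteq> D"
    using assms open_contains_ball by blast
  obtain d1 where d1: "d1 > 0"
    "\<And>z. dist z x < d1 \<Longrightarrow> dist (partial i (partial j f) z) (partial i (partial j f) x) < \<epsilon>"
    using cont[of i j] \<epsilon> unfolding continuous_at_eps_delta by blast
  obtain d2 where d2: "d2 > 0"
    "\<And>z. dist z x < d2 \<Longrightarrow> dist (partial j (partial i f) z) (partial j (partial i f) x) < \<epsilon>"
    using cont[of j i] \<epsilon> unfolding continuous_at_eps_delta by blast
  \<comment> \<open>Division by 3 keeps \<open>2 * t\<close>, the distance bound from the second
    difference, strictly below all three radii.\<close>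
  define t where "t = min r (min d1 d2) / 3"
  have t: "0 < t" "2 * t < r" "2 * t < d1" "2 * t < d2"
    using r d1 d2 by (auto simp: t_def min_def)
  have diff: "f differentiable (at y)" "partial k f differentiable (at y)" if "y \<in> ball x r" for y k
    using that r assms smooth_on_partial smooth_on_differentiable by blast+
  obtain z where z: "dist x z \<le> 2 * t"
    "f (x + t *\<^sub>R axis i 1 + t *\<^sub>R axis j 1) - f (x + t *\<^sub>R axis i 1) - f (x + t *\<^sub>R axis j 1) + f x
      = t * t * partial j (partial i f) z"
    using second_difference_mean_value[of x r f i t j] diff t by blast
  obtain w where w: "dist x w \<le> 2 * t"
    "f (x + t *\<^sub>R axis j 1 + t *\<^sub>R axis i 1) - f (x + t *\<^sub>R axis j 1) - f (x + t *\<^sub>R axis i 1) + f x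
      = t * t * partial i (partial j f) w"
    using second_difference_mean_value[of x r f j t i] diff t by blast
  have "x + t *\<^sub>R axis j 1 + t *\<^sub>R axis i 1 = x + t *\<^sub>R axis i 1 + t *\<^sub>R axis j 1"
    by simp
  with z(2) w(2) have "t * t * partial j (partial i f) z = t * t * partial i (partial j f) w"
    by (smt (verit))
  with t have eq: "partial j (partial i f) z = partial i (partial j f) w"
    by simp
  have "\<bar>partial i (partial j f) w - partial i (partial j f) x\<bar> < \<epsilon>"
    using d1(2)[of w] w(1) t by (simp add: dist_commute dist_real_def)
  moreover have "\<bar>partial j (partial i f) z - partial j (partial i f) x\<bar> < \<epsilon>"
    using d2(2)[of z] z(1) t by (simp add: dist_commute dist_real_def)
  ultimately show False
    using ne unfolding eq \<epsilon>_def by (simp add: abs_if split: if_splits)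
qed

section \<open>Algebraic rules for partial derivatives\<close>

lemma partial_add:
  assumes "f differentiable (at x)" "h differentiable (at x)"
  shows "partial i (\<lambda>y. f y + h y) x = partial i f x + partial i h x"
  using has_derivative_add[OF assms[unfolded frechet_derivative_works]]
  unfolding partial_def by (simp add: frechet_derivative_at[symmetric])

lemma partial_diff:
  assumes "f differentiable (at x)" "h differentiable (at x)"
  shows "partial i (\<lambda>y. f y - h y) x = partial i f x - partial i h x"
  using has_derivative_diff[OF assms[unfolded frechet_derivative_works]]
  unfolding partial_def by (simp add: frechet_derivative_at[symmetric])

lemma partial_sum:
  assumes "\<And>a. a \<in> I \<Longrightarrow> f a differentiable (at x)"
  shows "partial i (\<lambda>y. \<Sum>a\<in>I. f a y) x = (\<Sum>a\<in>I. partial i (f a) x)"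
proof -
  have "((\<lambda>y. \<Sum>a\<in>I. f a y) has_derivative (\<lambda>v. \<Sum>a\<in>I. frechet_derivative (f a) (at x) v)) (at x)"
    using assms by (intro has_derivative_sum) (simp add: frechet_derivative_works[symmetric])
  then show ?thesis
    unfolding partial_def by (simp add: frechet_derivative_at[symmetric])
qed

lemma partial_mult:
  fixes f h :: "real^'n::finite \<Rightarrow> real"
  assumes "f differentiable (at x)" "h differentiable (at x)"
  shows "partial i (\<lambda>y. f y * h y) x = partial i f x * h x + f x * partial i h x"
  using has_derivative_mult[OF assms[unfolded frechet_derivative_works]]
  unfolding partial_def by (simp add: frechet_derivative_at[symmetric])

section \<open>Differentiability of the inverse matrix\<close>

lemma matrix_inv_inverse:
  fixes A :: "real^'n::finite^'n"
  assumes "invertible A"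
  shows "A ** matrix_inv A = mat 1" "matrix_inv A ** A = mat 1"
  using someI_ex[OF assms[unfolded invertible_def]] by (auto simp: matrix_inv_def)

text \<open>Column \<open>l\<close> of the inverse solves a linear system with right-hand side
  \<open>axis l 1\<close>, so Cramer's rule applies. The entries become quotients of polynomials in
  the entries of \<open>A\<close>, which makes them accessible to the product and quotient
  rules.\<close>

lemma matrix_inv_cramer:
  fixes A :: "real^'n::finite^'n"
  assumes "invertible A"
  shows "matrix_inv A $ m $ l = det (\<chi> i j. if j = m then axis l 1 $ i else A $ i $ j) / det A"
proof -
  have "A *v (matrix_inv A *v axis l 1) = axis l 1"
    by (simp add: matrix_vector_mul_assoc matrix_inv_inverse[OF assms])
  then have "(matrix_inv A *v axis l 1) $ m =
      det (\<chi> i j. if j = m then axis l 1 $ i else A $ i $ j) / det A"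
    using cramer[of A "matrix_inv A *v axis l 1" "axis l 1"] assms invertible_det_nz
    by (metis (no_types, lifting) vec_lambda_beta)
  then show ?thesis
    by (simp add: matrix_vector_mult_basis column_def)
qed

lemma differentiable_det:
  fixes B :: "'a::real_normed_vector \<Rightarrow> real^'n::finite^'n"
  assumes "\<And>i j. (\<lambda>y. B y $ i $ j) differentiable (at x)"
  shows "(\<lambda>y. det (B y)) differentiable (at x)"
proof -
  have "(\<lambda>y. \<Prod>i\<in>UNIV. B y $ i $ p i) differentiable (at x)" for p
    unfolding differentiable_def
    by (rule exI, rule has_derivative_prod, rule assms[unfolded frechet_derivative_works])
  then show ?thesis
    unfolding det_def by (intro differentiable_sum ballI differentiable_mult) simp_all
qed

lemma differentiable_matrix_inv:
  fixes B :: "'a::real_normed_vector \<Rightarrow> real^'n::finite^'n"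
  assumes "\<And>i j. (\<lambda>y. B y $ i $ j) differentiable (at x)"
    and "open D" "x \<in> D" "\<And>y. y \<in> D \<Longrightarrow> invertible (B y)"
  shows "(\<lambda>y. matrix_inv (B y) $ m $ l) differentiable (at x)"
proof -
  \<comment> \<open>In column \<open>m\<close> the entries are constant in \<open>y\<close>; the
    others are entries of \<open>B y\<close>.\<close>
  have "(\<lambda>y. (\<chi> i j. if j = m then axis l 1 $ i else B y $ i $ j) $ i $ j) differentiable (at x)"
    for i j using assms(1) by (cases "j = m") simp_all
  then have "(\<lambda>y. det (\<chi> i j. if j = m then axis l 1 $ i else B y $ i $ j) / det (B y))
      differentiable (at x)"
    using assms by (intro differentiable_divide differentiable_det) (auto simp: invertible_det_nz)
  then show ?thesis
    by (rule differentiable_transform_open[OF _ assms(2,3)]) (simp add: matrix_inv_cramer assms(4))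
qed


section \<open>Operators on bivectors\<close>

text \<open>Both sides are linear in \<open>v\<close>, so it suffices to compare them on the vectors
  \<open>b K\<close>. The form \<open>Q\<close> is left abstract so that the result serves both
  \<open>metric_at\<close> on tangent vectors and \<open>bivector_metric\<close> on
  bivectors.\<close>

lemma orthonormal_expansion:
  fixes b :: "'i \<Rightarrow> 'v::real_vector" and Q :: "'v \<Rightarrow> 'v \<Rightarrow> real"
  assumes "finite I" and lin: "\<And>v. linear (\<lambda>u. Q u v)"
    and on: "\<And>J K. J \<in> I \<Longrightarrow> K \<in> I \<Longrightarrow> Q (b J) (b K) = (if J = K then 1 else 0)"
    and v: "v \<in> span (b ` I)"
  shows "v = (\<Sum>J\<in>I. Q v (b J) *\<^sub>R b J)"
  using v
proof (induction rule: span_induct_alt)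
  case base
  show ?case using linear_0[OF lin] by simp
next
  case (step c u v)
  then obtain K where K: "K \<in> I" "u = b K" by blast
  have "(\<Sum>J\<in>I. Q u (b J) *\<^sub>R b J) = (\<Sum>J\<in>I. if K = J then b J else 0)"
    using K on by (intro sum.cong) auto
  then have "(\<Sum>J\<in>I. Q u (b J) *\<^sub>R b J) = u"
    using K assms(1) by simp
  moreover have "(\<Sum>J\<in>I. Q (c *\<^sub>R u + v) (b J) *\<^sub>R b J) =
      c *\<^sub>R (\<Sum>J\<in>I. Q u (b J) *\<^sub>R b J) + (\<Sum>J\<in>I. Q v (b J) *\<^sub>R b J)"
    by (simp add: linear_add[OF lin] linear_cmul[OF lin] scaleR_sum_right sum.distrib scaleR_left_distrib)
  ultimately show ?case using step by simp
qed

text \<open>If \<open>b J\<close> were in the span of the others, its expansion in them would have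
  only zero coefficients, so \<open>b J = 0\<close>, against
  \<open>Q (b J) (b J) = 1\<close>.\<close>

lemma orthonormal_inj_independent:
  fixes b :: "'i \<Rightarrow> 'v::real_vector" and Q :: "'v \<Rightarrow> 'v \<Rightarrow> real"
  assumes "finite I" and lin: "\<And>v. linear (\<lambda>u. Q u v)"
    and on: "\<And>J K. J \<in> I \<Longrightarrow> K \<in> I \<Longrightarrow> Q (b J) (b K) = (if J = K then 1 else 0)"
  shows "inj_on b I" "independent (b ` I)"
proof -
  show inj: "inj_on b I"
    using on by (metis inj_onI zero_neq_one)
  show "independent (b ` I)"
    unfolding dependent_def
  proof
    assume "\<exists>a\<in>b ` I. a \<in> span (b ` I - {a})"
    then obtain J where J: "J \<in> I" "b J \<in> span (b ` I - {b J})" by blast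
    have "b ` I - {b J} = b ` (I - {J})"
      using inj J(1) by (auto simp: inj_on_def)
    then have "b J = (\<Sum>K\<in>I - {J}. Q (b J) (b K) *\<^sub>R b K)"
      using J(2) by (intro orthonormal_expansion) (simp_all add: assms)
    also have "\<dots> = 0"
      using on J(1) by (intro sum.neutral) auto
    finally have "Q (b J) (b J) = 0"
      using linear_0[OF lin, of "b J"] by simp
    then show False using on J(1) by simp
  qed
qed

section \<open>Linearity of the metrics and of the wedge product\<close>

lemma metric_at_linear:
  "linear (\<lambda>X. metric_at G x X Y)" "linear (\<lambda>Y. metric_at G x X Y)"
  by (auto intro!: linearI simp: metric_at_def inner_left_distrib inner_right_distrib
      matrix_vector_mult_scaleR matrix_vector_right_distrib)

lemma metric_at_commute:
  assumes "transpose (G x) = G x"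
  shows "metric_at G x X Y = metric_at G x Y X"
proof -
  have "X \<bullet> (G x *v Y) = (transpose (G x) *v X) \<bullet> Y"
    by (simp only: dot_lmul_matrix transpose_matrix_vector)
  then show ?thesis
    by (simp only: assms metric_at_def inner_commute)
qed

lemma bivector_metric_linear: "linear (\<lambda>\<omega>. bivector_metric G x \<omega> \<eta>)"
  by (rule linearI)
    (simp_all add: bivector_metric.rep_eq plus_bivector.rep_eq scaleR_bivector.rep_eq
      algebra_simps sum.distrib sum_distrib_left)

lemma wedge_linear: "linear (\<lambda>X. wedge X Y)" "linear (\<lambda>Y. wedge X Y)"
  by (rule linearI; transfer; simp add: vec_eq_iff algebra_simps)+

text \<open>An antisymmetric matrix is half the sum of its entries times the coordinate wedges; the
  factor 1/2 appears because each unordered pair of indices is counted twice.\<close>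

lemma span_range_wedge: "span {wedge X Y | X Y :: real^'n::finite. True} = UNIV"
proof -
  have rep: "Rep_bivector (\<Sum>i\<in>I. f i) = (\<Sum>i\<in>I. Rep_bivector (f i))" for I and f :: "'i \<Rightarrow> 'n bivector"
    by (induction I rule: infinite_finite_induct)
      (simp_all add: zero_bivector.rep_eq plus_bivector.rep_eq)
  have expansion: "\<omega> = (1/2) *\<^sub>R (\<Sum>i\<in>UNIV. \<Sum>j\<in>UNIV. Rep_bivector \<omega> $ i $ j *\<^sub>R wedge (axis i 1) (axis j 1))"
    for \<omega> :: "'n bivector"
  proof -
    have anti: "Rep_bivector \<omega> $ j $ i = - Rep_bivector \<omega> $ i $ j" for i j
    proof -
      have "transpose (Rep_bivector \<omega>) $ i $ j = (- Rep_bivector \<omega>) $ i $ j"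
        using Rep_bivector[of \<omega>] by simp
      then show ?thesis by (simp add: transpose_def)
    qed
    have entry: "(\<Sum>i\<in>UNIV. \<Sum>j\<in>UNIV. a i j * (axis i 1 $ k * axis j 1 $ l)) = a k l"
      for a :: "'n \<Rightarrow> 'n \<Rightarrow> real" and k l
    proof -
      have "(\<Sum>i\<in>UNIV. \<Sum>j\<in>UNIV. a i j * (axis i 1 $ k * axis j 1 $ l)) =
          (\<Sum>i\<in>UNIV. if i = k then \<Sum>j\<in>UNIV. if j = l then a i j else 0 else 0)"
        by (auto simp: axis_def if_distrib[of "(*) _"] cong: if_cong intro!: sum.cong)
      then show ?thesis by simp
    qed
    have "(\<Sum>i\<in>UNIV. \<Sum>j\<in>UNIV. Rep_bivector \<omega> $ i $ j *
        (axis i 1 $ k * axis j 1 $ l - axis i 1 $ l * axis j 1 $ k)) =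
        2 * Rep_bivector \<omega> $ k $ l" for k l
      using anti[of l k] by (simp only: right_diff_distrib sum_subtractf entry)
    then show ?thesis
      by (simp add: Rep_bivector_inject[symmetric] rep scaleR_bivector.rep_eq wedge.rep_eq vec_eq_iff)
  qed
  have "(1/2) *\<^sub>R (\<Sum>i\<in>UNIV. \<Sum>j\<in>UNIV. Rep_bivector \<omega> $ i $ j *\<^sub>R wedge (axis i 1) (axis j 1))
      \<in> span {wedge X Y | X Y :: real^'n. True}" for \<omega>
    by (intro span_scale span_sum) (auto intro: span_base)
  then have "\<omega> \<in> span {wedge X Y | X Y :: real^'n. True}" for \<omega>
    by (subst expansion)
  then show ?thesis by blast
qed

lemma linear_eq_on_wedges:
  fixes F H :: "'n::finite bivector \<Rightarrow> 'v::real_vector"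
  assumes "linear F" "linear H" "\<And>X Y. F (wedge X Y) = H (wedge X Y)"
  shows "F = H"
proof
  fix \<omega>
  show "F \<omega> = H \<omega>"
    using linear_eq_on[OF assms(1,2), of \<omega> "{wedge X Y | X Y. True}"] assms(3)
    unfolding span_range_wedge by blast
qed

text \<open>The property that lets \<open>T\<close> descend to a bilinear form on bivectors.
  Linearity in the second and fourth slots follows from the first and third by antisymmetry.\<close>

definition pairwise_alternating ::
    "('v::real_vector \<Rightarrow> 'v \<Rightarrow> 'v \<Rightarrow> 'v \<Rightarrow> real) \<Rightarrow> bool" where
  "pairwise_alternating T \<longleftrightarrow>
     (\<forall>Y Z W. linear (\<lambda>X. T X Y Z W)) \<and> (\<forall>X Y W. linear (\<lambda>Z. T X Y Z W)) \<and>
     (\<forall>X Y Z W. T Y X Z W = - T X Y Z W) \<and> (\<forall>X Y Z W. T X Y W Z = - T X Y Z W)"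

lemma pairwise_alternatingD:
  assumes "pairwise_alternating T"
  shows "linear (\<lambda>X. T X Y Z W)" "linear (\<lambda>Z. T X Y Z W)"
    "T Y X Z W = - T X Y Z W" "T X Y W Z = - T X Y Z W"
  by (rule assms[unfolded pairwise_alternating_def, THEN conjunct1, rule_format]
      assms[unfolded pairwise_alternating_def, THEN conjunct2, THEN conjunct1, rule_format]
      assms[unfolded pairwise_alternating_def, THEN conjunct2, THEN conjunct2, THEN conjunct1, rule_format]
      assms[unfolded pairwise_alternating_def, THEN conjunct2, THEN conjunct2, THEN conjunct2, rule_format])+

lemma pairwise_alternating_diff:
  assumes "pairwise_alternating T" "pairwise_alternating T'"
  shows "pairwise_alternating (\<lambda>X Y Z W. T X Y Z W - T' X Y Z W)"
proof -
  note T = pairwise_alternatingD[OF assms(1)] and T' = pairwise_alternatingD[OF assms(2)]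
  have "T Y X Z W - T' Y X Z W = - (T X Y Z W - T' X Y Z W)"
    "T X Y W Z - T' X Y W Z = - (T X Y Z W - T' X Y Z W)" for X Y Z W
    using T(3)[of Y X Z W] T'(3)[of Y X Z W] T(4)[of X Y W Z] T'(4)[of X Y W Z] by simp_all
  then show ?thesis
    unfolding pairwise_alternating_def
    by (intro conjI allI linear_compose_sub T(1,2) T'(1,2))
qed

lemma pairwise_alternating_kulkarni_nomizu:
  assumes "\<And>Y. linear (\<lambda>X. S X Y)" "\<And>X. linear (S X)" "\<And>Y. linear (\<lambda>X. T X Y)" "\<And>X. linear (T X)"
  shows "pairwise_alternating (kulkarni_nomizu S T)"
  unfolding pairwise_alternating_def kulkarni_nomizu_def
  by (auto intro!: linearI simp: linear_add[OF assms(1)] linear_add[OF assms(2)] linear_add[OF assms(3)]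
      linear_add[OF assms(4)] linear_cmul[OF assms(1)] linear_cmul[OF assms(2)] linear_cmul[OF assms(3)]
      linear_cmul[OF assms(4)] algebra_simps)

text \<open>Linear algebra at a single point, for an arbitrary orthonormal frame; the Ricci
  eigenvalue condition enters only in the final theorem.\<close>

locale frame_at =
  fixes G :: "real^'n::finite \<Rightarrow> real^'n^'n" and x :: "real^'n" and e :: "nat \<Rightarrow> real^'n" and n :: nat
  assumes dim: "n = CARD('n)" and metric_sym: "transpose (G x) = G x" and orthonormal: "orthonormal_frame G x e"
begin

abbreviation "pairs \<equiv> {(i, j). 1 \<le> i \<and> i < j \<and> j \<le> n}"
abbreviation "frame_wedge \<equiv> \<lambda>(i, j). wedge (e i) (e j)"

lemma metric_commute: "metric_at G x X Y = metric_at G x Y X"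
  by (rule metric_at_commute) (rule metric_sym)

lemma metric_frame:
  "i \<in> {1..n} \<Longrightarrow> j \<in> {1..n} \<Longrightarrow> metric_at G x (e i) (e j) = (if i = j then 1 else 0)"
  using orthonormal dim by (simp add: orthonormal_frame_def)

text \<open>An orthonormal family is independent, and \<open>n\<close> independent vectors span a
  space of dimension \<open>n\<close>.\<close>

lemma span_frame: "span (e ` {1..n}) = UNIV"
proof -
  note * = orthonormal_inj_independent[of "{1..n}" "metric_at G x" e,
      OF _ metric_at_linear(1) metric_frame]
  have "card (e ` {1..n}) = DIM(real^'n)"
    using card_image[OF *(1)] dim by simp
  then show ?thesis
    using *(2) by (metis dim_UNIV card_ge_dim_independent le_refl subset_UNIV top.extremum_unique finite_atLeastAtMost)
qed

lemma frame_expansion: "X = (\<Sum>i=1..n. metric_at G x X (e i) *\<^sub>R e i)"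
  by (rule orthonormal_expansion[OF _ metric_at_linear(1) metric_frame]) (simp_all add: span_frame[simplified])

lemma linear_frame_expansion:
  assumes "linear (f :: real^'n \<Rightarrow> 'v::real_vector)"
  shows "f X = (\<Sum>i=1..n. metric_at G x X (e i) *\<^sub>R f (e i))"
proof -
  have "f X = f (\<Sum>i=1..n. metric_at G x X (e i) *\<^sub>R e i)"
    using frame_expansion by (rule arg_cong)
  then show ?thesis
    by (simp only: linear_sum[OF assms] linear_cmul[OF assms])
qed

text \<open>The determinant formula for the metric on wedges splits the sum into the frame
  expansions of \<open>\<beta> X Y\<close> and \<open>\<beta> Y X\<close>, with opposite signs. The
  factor 2 reflects the sum over all pairs of indices instead of increasing ones.\<close>

lemma alternating_frame_expansion:
  fixes \<beta> :: "real^'n \<Rightarrow> real^'n \<Rightarrow> real"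
  assumes lin: "\<And>Y. linear (\<lambda>X. \<beta> X Y)" and alt: "\<And>X Y. \<beta> Y X = - \<beta> X Y"
  shows "(\<Sum>i=1..n. \<Sum>j=1..n.
      bivector_metric G x (wedge X Y) (wedge (e i) (e j)) * \<beta> (e i) (e j)) = 2 * \<beta> X Y"
proof -
  have lin': "linear (\<beta> X)" for X
    using linear_compose_neg[OF lin[of X]] unfolding alt[symmetric] .
  have exp: "(\<Sum>i=1..n. \<Sum>j=1..n.
      metric_at G x X (e i) * metric_at G x Y (e j) * \<beta> (e i) (e j)) = \<beta> X Y" for X Y
  proof -
    have "\<beta> X Y = (\<Sum>i=1..n. metric_at G x X (e i) * \<beta> (e i) Y)"
      by (rule linear_frame_expansion[OF lin, unfolded real_scaleR_def])
    also have "\<dots> = (\<Sum>i=1..n. metric_at G x X (e i) *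
        (\<Sum>j=1..n. metric_at G x Y (e j) * \<beta> (e i) (e j)))"
      by (rule sum.cong[OF refl], rule arg_cong[OF linear_frame_expansion[OF lin', unfolded real_scaleR_def]])
    finally show ?thesis by (simp add: sum_distrib_left mult.assoc)
  qed
  have "(\<Sum>i=1..n. \<Sum>j=1..n.
      bivector_metric G x (wedge X Y) (wedge (e i) (e j)) * \<beta> (e i) (e j)) = \<beta> X Y - \<beta> Y X"
    unfolding exp[symmetric, of X Y] exp[symmetric, of Y X]
    by (simp add: bivector_metric_wedge sum_subtractf algebra_simps)
  then show ?thesis using alt[of X Y] by simp
qed

lemma frame_wedge_orthonormal:
  "J \<in> pairs \<Longrightarrow> K \<in> pairs \<Longrightarrow>
    bivector_metric G x (frame_wedge J) (frame_wedge K) = (if J = K then 1 else 0)"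
  using bivector_metric_orthonormal[OF orthonormal, folded dim] by (cases J, cases K) auto

lemma finite_pairs: "finite pairs"
  by (rule finite_subset[of _ "{..n} \<times> {..n}"]) auto

text \<open>Expanding both factors of \<open>wedge X Y\<close> in the frame leaves wedges of frame
  vectors; antisymmetry orders their indices and kills the repeated ones.\<close>

lemma span_frame_wedge: "span (frame_wedge ` pairs) = UNIV"
proof -
  have ordered: "wedge (e i) (e j) \<in> span (frame_wedge ` pairs)"
    if "i \<in> {1..n}" "j \<in> {1..n}" for i j
  proof -
    have *: "wedge (e i) (e j) \<in> span (frame_wedge ` pairs)" if "1 \<le> i" "i < j" "j \<le> n" for i j
      using that by (intro span_base) (auto intro!: image_eqI[of _ _ "(i, j)"])
    have swap: "wedge X Y = - wedge Y X" for X Y :: "real^'n"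
      by transfer (simp add: vec_eq_iff)
    have "wedge X X = 0" for X :: "real^'n"
      by transfer (simp add: vec_eq_iff)
    then show ?thesis
      using *[of i j] *[of j i] swap[of "e i" "e j"] that span_neg
      by (cases i j rule: linorder_cases) (auto simp: span_zero)
  qed
  have expansion: "wedge X Y = (\<Sum>i=1..n. \<Sum>j=1..n.
      metric_at G x X (e i) *\<^sub>R metric_at G x Y (e j) *\<^sub>R wedge (e i) (e j))" for X Y
  proof -
    have "wedge X Y = (\<Sum>i=1..n. metric_at G x X (e i) *\<^sub>R wedge (e i) Y)"
      by (rule linear_frame_expansion[OF wedge_linear(1)])
    also have "\<dots> = (\<Sum>i=1..n. metric_at G x X (e i) *\<^sub>R
        (\<Sum>j=1..n. metric_at G x Y (e j) *\<^sub>R wedge (e i) (e j)))"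
      using linear_frame_expansion[OF wedge_linear(2), of _ Y] by (intro sum.cong refl) simp
    finally show ?thesis by (simp only: scaleR_sum_right)
  qed
  have "wedge X Y \<in> span (frame_wedge ` pairs)" for X Y
    unfolding expansion[of X Y] by (intro span_sum span_scale ordered)
  then have "{wedge X Y | X Y :: real^'n. True} \<subseteq> span (frame_wedge ` pairs)"
    by auto
  then have "span {wedge X Y | X Y :: real^'n. True} \<subseteq> span (frame_wedge ` pairs)"
    using span_minimal subspace_span by blast
  then show ?thesis using span_range_wedge by auto
qed

lemma bivector_expansion:
  "\<omega> = (\<Sum>J\<in>pairs. bivector_metric G x \<omega> (frame_wedge J) *\<^sub>R frame_wedge J)"
  by (rule orthonormal_expansion[OF finite_pairs bivector_metric_linear frame_wedge_orthonormal])
    (simp_all only: span_frame_wedge UNIV_I)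

text \<open>Nondegeneracy: the coefficients in \<open>bivector_expansion\<close> are themselves
  products with wedges.\<close>

lemma bivector_eqI:
  assumes "\<And>Z W. bivector_metric G x \<omega> (wedge Z W) = bivector_metric G x \<eta> (wedge Z W)"
  shows "\<omega> = \<eta>"
  by (rule trans[OF bivector_expansion trans[OF _ bivector_expansion[symmetric]]])
    (simp add: assms case_prod_beta)

text \<open>Uniqueness for the definite description: by nondegeneracy two solutions agree on all
  wedges, and wedges span.\<close>

lemma bivector_operator_eqI:
  assumes "linear F" "\<And>X Y Z W. bivector_metric G x (F (wedge X Y)) (wedge Z W) = T X Y Z W"
  shows "bivector_operator G x T = F"
  unfolding bivector_operator_def
proof (rule the_equality)
  show "linear F \<and> (\<forall>X Y Z W. bivector_metric G x (F (wedge X Y)) (wedge Z W) = T X Y Z W)"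
    using assms by blast
next
  fix H assume "linear H \<and> (\<forall>X Y Z W. bivector_metric G x (H (wedge X Y)) (wedge Z W) = T X Y Z W)"
  with assms show "H = F"
    by (intro linear_eq_on_wedges bivector_eqI) auto
qed

text \<open>Existence for the definite description, without which \<open>bivector_operator\<close>
  would be unspecified.\<close>

lemma bivector_operator_works:
  assumes "pairwise_alternating T"
  shows "linear (bivector_operator G x T)"
    and "bivector_metric G x (bivector_operator G x T (wedge X Y)) (wedge Z W) = T X Y Z W"
proof -
  \<comment> \<open>The sums run over all index pairs, so that
    \<open>alternating_frame_expansion\<close> applies once in each pair of slots; each application
    contributes a factor 2, which \<open>1/4\<close> compensates.\<close>
  define F where "F \<omega> = (1/4) *\<^sub>R (\<Sum>i=1..n. \<Sum>j=1..n.
    bivector_metric G x \<omega> (wedge (e i) (e j)) *\<^sub>R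
      (\<Sum>k=1..n. \<Sum>l=1..n. T (e i) (e j) (e k) (e l) *\<^sub>R wedge (e k) (e l)))" for \<omega>
  note lin = linear_add[OF bivector_metric_linear] linear_cmul[OF bivector_metric_linear]
    linear_sum[OF bivector_metric_linear]
  have "linear F"
  proof -
    have "linear (\<lambda>\<omega>. bivector_metric G x \<omega> \<eta> *\<^sub>R \<theta>)" for \<eta> \<theta> :: "'n bivector"
      by (rule linearI) (simp_all add: lin scaleR_left_distrib)
    then show ?thesis
      unfolding F_def by (intro linear_compose_scale_right linear_compose_sum ballI)
  qed
  moreover have "bivector_metric G x (F (wedge X Y)) (wedge Z W) = T X Y Z W" for X Y Z W
  proof -
    have swap: "bivector_metric G x (wedge (e k) (e l)) (wedge Z W) =
        bivector_metric G x (wedge Z W) (wedge (e k) (e l))" for k l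
      by (simp add: bivector_metric_wedge metric_commute[of "e _"])
    have inner: "(\<Sum>k=1..n. \<Sum>l=1..n.
        T (e i) (e j) (e k) (e l) * bivector_metric G x (wedge (e k) (e l)) (wedge Z W)) =
        2 * T (e i) (e j) Z W" for i j
      unfolding swap mult.commute[of "T _ _ _ _"]
      by (intro alternating_frame_expansion) (rule pairwise_alternatingD[OF assms])+
    have "bivector_metric G x (F (wedge X Y)) (wedge Z W) =
        1/4 * (\<Sum>i=1..n. \<Sum>j=1..n.
          bivector_metric G x (wedge X Y) (wedge (e i) (e j)) * (2 * T (e i) (e j) Z W))"
      unfolding F_def by (simp only: lin real_scaleR_def inner)
    also have "\<dots> = 1/2 * (\<Sum>i=1..n. \<Sum>j=1..n.
        bivector_metric G x (wedge X Y) (wedge (e i) (e j)) * T (e i) (e j) Z W)"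
      unfolding sum_distrib_left by (intro sum.cong refl) simp
    also have "(\<Sum>i=1..n. \<Sum>j=1..n.
        bivector_metric G x (wedge X Y) (wedge (e i) (e j)) * T (e i) (e j) Z W) = 2 * T X Y Z W"
      by (intro alternating_frame_expansion) (rule pairwise_alternatingD[OF assms])+
    also have "1/2 * (2 * T X Y Z W) = T X Y Z W"
      by simp
    finally show ?thesis .
  qed
  ultimately have "linear F \<and> (\<forall>X Y Z W. bivector_metric G x (F (wedge X Y)) (wedge Z W) = T X Y Z W)"
    by blast
  then show "linear (bivector_operator G x T)"
    "bivector_metric G x (bivector_operator G x T (wedge X Y)) (wedge Z W) = T X Y Z W"
    using bivector_operator_eqI[of F T] by auto
qed

text \<open>In an orthonormal basis the coefficient of the image of \<open>J\<close> along
  \<open>K\<close> is its product with \<open>K\<close>. As rows come first, \<open>A\<close> takes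
  its two index pairs in the opposite order to \<open>T\<close>.\<close>

lemma bivector_operator_has_matrix:
  assumes "pairwise_alternating T"
    and "\<And>i j k l. (i, j) \<in> pairs \<Longrightarrow> (k, l) \<in> pairs \<Longrightarrow> A (k, l) (i, j) = T (e i) (e j) (e k) (e l)"
  shows "has_matrix_in_basis (bivector_operator G x T) pairs frame_wedge A"
proof -
  have "bivector_operator G x T (frame_wedge J) = (\<Sum>K\<in>pairs. A K J *\<^sub>R frame_wedge K)"
    if "J \<in> pairs" for J
    by (rule trans[OF bivector_expansion], intro sum.cong refl)
      (use that assms(2) bivector_operator_works(2)[OF assms(1)] in auto)
  then show ?thesis
    unfolding has_matrix_in_basis_def
    using finite_pairs span_frame_wedge bivector_operator_works(1)[OF assms(1)]
      orthonormal_inj_independent[of pairs "bivector_metric G x" frame_wedge,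
        OF finite_pairs bivector_metric_linear frame_wedge_orthonormal]
    by blast
qed

end


section \<open>Symmetries of the curvature tensor\<close>

lemma sum_swap_pairs:
  "(\<Sum>i\<in>A. \<Sum>j\<in>B. \<Sum>k\<in>C. \<Sum>l\<in>D. f i j k l) = (\<Sum>k\<in>C. \<Sum>l\<in>D. \<Sum>i\<in>A. \<Sum>j\<in>B. f i j k l)"
proof -
  have "(\<Sum>i\<in>A. \<Sum>j\<in>B. \<Sum>k\<in>C. \<Sum>l\<in>D. f i j k l) = (\<Sum>i\<in>A. \<Sum>k\<in>C. \<Sum>j\<in>B. \<Sum>l\<in>D. f i j k l)"
    by (rule sum.cong[OF refl], rule sum.swap)
  also have "\<dots> = (\<Sum>k\<in>C. \<Sum>i\<in>A. \<Sum>j\<in>B. \<Sum>l\<in>D. f i j k l)"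
    by (rule sum.swap)
  also have "\<dots> = (\<Sum>k\<in>C. \<Sum>i\<in>A. \<Sum>l\<in>D. \<Sum>j\<in>B. f i j k l)"
    by (rule sum.cong[OF refl], rule sum.cong[OF refl], rule sum.swap)
  also have "\<dots> = (\<Sum>k\<in>C. \<Sum>l\<in>D. \<Sum>i\<in>A. \<Sum>j\<in>B. f i j k l)"
    by (rule sum.cong[OF refl], rule sum.swap)
  finally show ?thesis .
qed

text \<open>The symmetries of curvature are local, so they are derived for a metric on an open set
  of coordinates; the manifold later only supplies a chart.\<close>

locale metric_on_open =
  fixes G :: "real^'n::finite \<Rightarrow> real^'n^'n" and D :: "(real^'n) set"
  assumes open_D: "open D" and smooth: "smooth_on D G"
    and G_sym: "y \<in> D \<Longrightarrow> transpose (G y) = G y"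
    and G_pos: "y \<in> D \<Longrightarrow> X \<noteq> 0 \<Longrightarrow> X \<bullet> (G y *v X) > 0"
begin

definition dg :: "'n \<Rightarrow> 'n \<Rightarrow> 'n \<Rightarrow> real^'n \<Rightarrow> real" where
  "dg a i j = partial a (\<lambda>y. G y $ i $ j)"

text \<open>The Christoffel symbol of the first kind, the product of
  \<open>\<nabla>\<^sub>i \<partial>\<^sub>j\<close> with \<open>\<partial>\<^sub>k\<close>.\<close>

definition lowered_christoffel :: "'n \<Rightarrow> 'n \<Rightarrow> 'n \<Rightarrow> real^'n \<Rightarrow> real" where
  "lowered_christoffel k i j y = (1/2) * (dg i j k y + dg j i k y - dg k i j y)"

definition Rm_component :: "real^'n \<Rightarrow> 'n \<Rightarrow> 'n \<Rightarrow> 'n \<Rightarrow> 'n \<Rightarrow> real" where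
  "Rm_component y i j k l = (\<Sum>m\<in>UNIV. G y $ k $ m * curvature_endo G y i j l m)"

lemma smooth_component: "smooth_on D (\<lambda>y. G y $ i $ j)"
  by (rule smooth_on_bounded_linear[OF _ open_D smooth])
    (rule bounded_linear_compose[OF bounded_linear_vec_nth bounded_linear_vec_nth])

lemma component_sym: "y \<in> D \<Longrightarrow> G y $ i $ j = G y $ j $ i"
  using G_sym[of y] by (metis transpose_def vec_lambda_beta)

lemma smooth_dg: "smooth_on D (dg a i j)"
  unfolding dg_def by (rule smooth_on_partial[OF smooth_component])

lemma dg_sym: "y \<in> D \<Longrightarrow> dg a i j y = dg a j i y"
  unfolding dg_def
  by (rule partial_transform_open[OF smooth_on_differentiable[OF smooth_component] open_D])
    (auto intro: component_sym)

lemma partial_dg_sym: "y \<in> D \<Longrightarrow> partial b (dg a i j) y = partial b (dg a j i) y"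
  by (rule partial_transform_open[OF smooth_on_differentiable[OF smooth_dg] open_D])
    (auto intro: dg_sym)

lemma partial_dg_commute: "y \<in> D \<Longrightarrow> partial b (dg a i j) y = partial a (dg b i j) y"
  unfolding dg_def by (rule partial_commute[OF open_D _ smooth_component])

section \<open>Christoffel symbols and their derivatives\<close>

lemma lowered_christoffel_sym: "y \<in> D \<Longrightarrow> lowered_christoffel k i j y = lowered_christoffel k j i y"
  using dg_sym[of y k i j] by (simp add: lowered_christoffel_def)

lemma lowered_christoffel_differentiable:
  "y \<in> D \<Longrightarrow> lowered_christoffel k i j differentiable (at y)"
  unfolding lowered_christoffel_def
  by (intro differentiable_mult differentiable_const differentiable_diff differentiable_add
      smooth_on_differentiable[OF smooth_dg])

lemma partial_lowered_christoffel:
  assumes "y \<in> D"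
  shows "partial a (lowered_christoffel k i j) y =
    (1/2) * (partial a (dg i j k) y + partial a (dg j i k) y - partial a (dg k i j) y)"
proof -
  note d = smooth_on_differentiable[OF smooth_dg assms]
  show ?thesis
    unfolding lowered_christoffel_def
    by (subst partial_bounded_linear[OF bounded_linear_mult_right])
      (simp_all add: partial_add partial_diff d)
qed

text \<open>The Levi-Civita connection preserves the metric: in the sum the derivatives in
  directions \<open>k\<close> and \<open>m\<close> cancel.\<close>

lemma metric_compatible:
  "y \<in> D \<Longrightarrow> dg a k m y = lowered_christoffel k a m y + lowered_christoffel m a k y"
  using dg_sym[of y a m k] by (simp add: lowered_christoffel_def field_simps)

text \<open>Positive definiteness excludes a nonzero kernel vector.\<close>

lemma invertible_metric:
  assumes "y \<in> D"
  shows "invertible (G y)"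
proof -
  have "X = 0" if "G y *v X = 0" for X
    using G_pos[OF assms, of X] that by auto
  then show ?thesis
    using invertible_left_inverse matrix_left_invertible_ker by blast
qed

lemma christoffel_eq:
  "christoffel G m i j y = (\<Sum>l\<in>UNIV. matrix_inv (G y) $ m $ l * lowered_christoffel l i j y)"
  by (simp add: christoffel_def lowered_christoffel_def dg_def sum_distrib_left mult.left_commute)

lemma christoffel_sym: "y \<in> D \<Longrightarrow> christoffel G m i j y = christoffel G m j i y"
  unfolding christoffel_eq by (simp add: lowered_christoffel_sym[of y _ i j])

lemma lower_christoffel:
  assumes "y \<in> D"
  shows "(\<Sum>m\<in>UNIV. G y $ k $ m * christoffel G m i j y) = lowered_christoffel k i j y"
proof -
  let ?v = "\<chi> l. lowered_christoffel l i j y"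
  have "(\<Sum>m\<in>UNIV. G y $ k $ m * christoffel G m i j y) = (G y *v (matrix_inv (G y) *v ?v)) $ k"
    by (simp add: matrix_vector_mult_def christoffel_eq)
  also have "\<dots> = lowered_christoffel k i j y"
    by (simp add: matrix_vector_mul_assoc matrix_inv_inverse invertible_metric assms)
  finally show ?thesis .
qed

lemma christoffel_differentiable: "y \<in> D \<Longrightarrow> christoffel G m i j differentiable (at y)"
  unfolding christoffel_eq[abs_def]
  by (intro differentiable_sum ballI differentiable_mult lowered_christoffel_differentiable
      differentiable_matrix_inv[OF smooth_on_differentiable[OF smooth_component] open_D])
    (simp_all add: invertible_metric)

text \<open>Obtained by differentiating the identity \<open>lower_christoffel\<close> with the
  product rule, which avoids an explicit derivative of the inverse metric.\<close>

lemma lower_partial_christoffel: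
  assumes "y \<in> D"
  shows "(\<Sum>m\<in>UNIV. G y $ k $ m * partial a (christoffel G m i j) y) =
    partial a (lowered_christoffel k i j) y - (\<Sum>m\<in>UNIV. dg a k m y * christoffel G m i j y)"
proof -
  note d = smooth_on_differentiable[OF smooth_component assms] christoffel_differentiable[OF assms]
  have "partial a (lowered_christoffel k i j) y =
      partial a (\<lambda>y. \<Sum>m\<in>UNIV. G y $ k $ m * christoffel G m i j y) y"
    by (rule partial_transform_open[OF lowered_christoffel_differentiable open_D])
      (simp_all add: assms lower_christoffel)
  also have "\<dots> = (\<Sum>m\<in>UNIV. dg a k m y * christoffel G m i j y + G y $ k $ m * partial a (christoffel G m i j) y)"
    by (simp add: partial_sum partial_mult d differentiable_mult dg_def)
  finally show ?thesis
    by (simp add: sum.distrib)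
qed

text \<open>The metric product \<open>P\<^sub>a\<^sub>b\<^sub>,\<^sub>c\<^sub>d\<close> of two
  Christoffel symbols, with the metric absorbed into the first factor.\<close>

definition christoffel_pairing :: "real^'n \<Rightarrow> 'n \<Rightarrow> 'n \<Rightarrow> 'n \<Rightarrow> 'n \<Rightarrow> real" where
  "christoffel_pairing y a b c d = (\<Sum>m\<in>UNIV. lowered_christoffel m a b y * christoffel G m c d y)"

lemma christoffel_pairing_sym:
  assumes "y \<in> D"
  shows "christoffel_pairing y a b c d = christoffel_pairing y c d a b"
    "christoffel_pairing y b a c d = christoffel_pairing y a b c d"
    "christoffel_pairing y a b d c = christoffel_pairing y a b c d"
proof -
  \<comment> \<open>Writing the metric out between the two Christoffel symbols makes the exchange of
    the pairs visible as symmetry of \<open>G y\<close>.\<close>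
  have eq: "christoffel_pairing y a b c d =
      (\<Sum>m\<in>UNIV. \<Sum>s\<in>UNIV. G y $ m $ s * christoffel G s a b y * christoffel G m c d y)" for a b c d
    by (simp add: christoffel_pairing_def lower_christoffel[OF assms, symmetric] sum_distrib_right)
  show "christoffel_pairing y a b c d = christoffel_pairing y c d a b"
    unfolding eq by (subst sum.swap) (simp add: component_sym[OF assms] mult_ac)
  show "christoffel_pairing y b a c d = christoffel_pairing y a b c d"
    "christoffel_pairing y a b d c = christoffel_pairing y a b c d"
    unfolding eq by (simp_all only: christoffel_sym[OF assms, of _ b a] christoffel_sym[OF assms, of _ d c])
qed

text \<open>Lowering the index turns each derivative of a Christoffel symbol into a derivative of a
  lowered one minus a \<open>dg\<close> term. By \<open>metric_compatible\<close> that term splits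
  in two: one half cancels a quadratic term of the curvature, the other is a
  \<open>christoffel_pairing\<close>.\<close>

lemma Rm_component_eq:
  assumes "y \<in> D"
  shows "Rm_component y i j k l =
    (1/2) * (partial i (dg l j k) y - partial i (dg k j l) y - partial j (dg l i k) y + partial j (dg k i l) y)
    - christoffel_pairing y i k j l + christoffel_pairing y j k i l"
proof -
  let ?\<Gamma> = "\<lambda>m i j. christoffel G m i j y" and ?L = "\<lambda>m i j. lowered_christoffel m i j y"
  have quadratic: "(\<Sum>m\<in>UNIV. G y $ k $ m * (\<Sum>s\<in>UNIV. ?\<Gamma> m a s * ?\<Gamma> s b c)) = (\<Sum>s\<in>UNIV. ?L k a s * ?\<Gamma> s b c)"
    for a b c
  proof -
    have "(\<Sum>m\<in>UNIV. G y $ k $ m * (\<Sum>s\<in>UNIV. ?\<Gamma> m a s * ?\<Gamma> s b c)) =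
        (\<Sum>s\<in>UNIV. (\<Sum>m\<in>UNIV. G y $ k $ m * ?\<Gamma> m a s) * ?\<Gamma> s b c)"
      unfolding sum_distrib_left sum_distrib_right by (subst sum.swap) (simp only: mult.assoc)
    then show ?thesis
      by (simp only: lower_christoffel[OF assms])
  qed
  have "Rm_component y i j k l =
      (\<Sum>m\<in>UNIV. G y $ k $ m * partial i (christoffel G m j l) y) -
      (\<Sum>m\<in>UNIV. G y $ k $ m * partial j (christoffel G m i l) y) +
      ((\<Sum>m\<in>UNIV. G y $ k $ m * (\<Sum>s\<in>UNIV. ?\<Gamma> m i s * ?\<Gamma> s j l)) -
       (\<Sum>m\<in>UNIV. G y $ k $ m * (\<Sum>s\<in>UNIV. ?\<Gamma> m j s * ?\<Gamma> s i l)))"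
    by (simp only: Rm_component_def curvature_endo_def sum_subtractf sum.distrib right_diff_distrib distrib_left)
  also have "\<dots> = partial i (lowered_christoffel k j l) y - partial j (lowered_christoffel k i l) y
      - christoffel_pairing y i k j l + christoffel_pairing y j k i l"
    by (simp add: quadratic lower_partial_christoffel[OF assms] metric_compatible[OF assms]
        christoffel_pairing_def distrib_right sum.distrib)
  finally show ?thesis
    \<comment> \<open>The second derivatives of the \<open>(l, k)\<close> entry in directions
      \<open>i\<close> and \<open>j\<close> occur with opposite signs and cancel.\<close>
    using partial_dg_commute[OF assms, of i j l k]
    by (simp add: partial_lowered_christoffel[OF assms] algebra_simps)
qed

text \<open>Exchanging \<open>i\<close> and \<open>j\<close> negates the closed formula term by
  term; exchanging \<open>k\<close> and \<open>l\<close> also calls for the symmetry of the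
  pairing.\<close>

lemma Rm_component_skew:
  assumes "y \<in> D"
  shows "Rm_component y j i k l = - Rm_component y i j k l"
    "Rm_component y i j l k = - Rm_component y i j k l"
  using christoffel_pairing_sym(1)[OF assms, of i l j k] christoffel_pairing_sym(1)[OF assms, of j l i k]
  by (simp_all add: Rm_component_eq[OF assms] field_simps)

text \<open>Read off from the closed formula, by commuting partial derivatives and the symmetries of
  the metric and the pairing, with no detour through the Bianchi identity.\<close>

lemma Rm_component_pair_sym:
  assumes "y \<in> D"
  shows "Rm_component y k l i j = Rm_component y i j k l"
proof -
  note P = christoffel_pairing_sym[OF assms]
  have "christoffel_pairing y k i l j = christoffel_pairing y i k j l"
    "christoffel_pairing y l i k j = christoffel_pairing y j k i l"
    using P by metis+
  then show ?thesis
    unfolding Rm_component_eq[OF assms]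
    using partial_dg_commute[OF assms, of k j l i] partial_dg_commute[OF assms, of k i l j]
      partial_dg_commute[OF assms, of l j k i] partial_dg_commute[OF assms, of l i k j]
      partial_dg_sym[OF assms, of j k l i] partial_dg_sym[OF assms, of i k l j]
      partial_dg_sym[OF assms, of j l k i] partial_dg_sym[OF assms, of i l k j]
    by simp
qed

section \<open>The curvature, Ricci, Schouten and Weyl tensors as multilinear forms\<close>

context
  fixes x assumes x: "x \<in> D"
begin

lemma Rm_eq: "Rm G x X Y Z W = (\<Sum>i\<in>UNIV. \<Sum>j\<in>UNIV. \<Sum>k\<in>UNIV. \<Sum>l\<in>UNIV.
    Rm_component x i j k l * X $ i * Y $ j * Z $ k * W $ l)"
  by (simp add: Rm_def Rm_component_def)

lemma Rm_skew:
  "Rm G x Y X Z W = - Rm G x X Y Z W" "Rm G x X Y W Z = - Rm G x X Y Z W"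
proof -
  have "Rm G x Y X Z W = (\<Sum>i\<in>UNIV. \<Sum>j\<in>UNIV. \<Sum>k\<in>UNIV. \<Sum>l\<in>UNIV.
      Rm_component x j i k l * Y $ j * X $ i * Z $ k * W $ l)"
    unfolding Rm_eq by (rule sum.swap)
  also have "\<dots> = - Rm G x X Y Z W"
    unfolding Rm_eq sum_negf[symmetric]
    by (intro sum.cong refl, subst Rm_component_skew(1)[OF x]) (simp add: mult_ac)
  finally show "Rm G x Y X Z W = - Rm G x X Y Z W" .
  have "Rm G x X Y W Z = (\<Sum>i\<in>UNIV. \<Sum>j\<in>UNIV. \<Sum>k\<in>UNIV. \<Sum>l\<in>UNIV.
      Rm_component x i j l k * X $ i * Y $ j * W $ l * Z $ k)"
    unfolding Rm_eq by (rule sum.cong[OF refl], rule sum.cong[OF refl], rule sum.swap)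
  also have "\<dots> = - Rm G x X Y Z W"
    unfolding Rm_eq sum_negf[symmetric]
    by (intro sum.cong refl, subst Rm_component_skew(2)[OF x]) (simp add: mult_ac)
  finally show "Rm G x X Y W Z = - Rm G x X Y Z W" .
qed

lemma Rm_pair_sym: "Rm G x Z W X Y = Rm G x X Y Z W"
proof -
  have "Rm G x Z W X Y = (\<Sum>i\<in>UNIV. \<Sum>j\<in>UNIV. \<Sum>k\<in>UNIV. \<Sum>l\<in>UNIV.
      Rm_component x k l i j * Z $ k * W $ l * X $ i * Y $ j)"
    unfolding Rm_eq by (rule sum_swap_pairs)
  also have "\<dots> = Rm G x X Y Z W"
    unfolding Rm_eq by (intro sum.cong refl, subst Rm_component_pair_sym[OF x]) (simp add: mult_ac)
  finally show ?thesis .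
qed

lemma Rm_linear:
  "linear (\<lambda>X. Rm G x X Y Z W)" "linear (\<lambda>Z. Rm G x X Y Z W)"
  by (rule linearI; simp add: Rm_eq algebra_simps sum.distrib sum_distrib_left)+

lemma pairwise_alternating_Rm: "pairwise_alternating (Rm G x)"
  unfolding pairwise_alternating_def by (intro conjI allI Rm_linear Rm_skew)

text \<open>Antisymmetry carries linearity over from the neighbouring slot.\<close>

lemma Rm_linear':
  "linear (\<lambda>Y. Rm G x X Y Z W)" "linear (\<lambda>W. Rm G x X Y Z W)"
proof -
  show "linear (\<lambda>Y. Rm G x X Y Z W)"
    unfolding Rm_skew(1)[of X] by (rule linear_compose_neg[OF Rm_linear(1)])
  show "linear (\<lambda>W. Rm G x X Y Z W)"
    unfolding Rm_skew(2)[of _ _ Z] by (rule linear_compose_neg[OF Rm_linear(2)])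
qed

lemma Ric_linear: "linear (\<lambda>Y. Ric G x Y W)" "linear (Ric G x Y)"
proof -
  have scale: "linear (\<lambda>X. c * f X)" if "linear f" for c and f :: "real^'n \<Rightarrow> real"
    using linear_compose_scale_right[OF that, of c] by simp
  show "linear (\<lambda>Y. Ric G x Y W)" "linear (Ric G x Y)"
    unfolding Ric_def[abs_def] by (intro linear_compose_sum ballI scale Rm_linear')+
qed

lemma schouten_linear: "linear (\<lambda>Y. schouten G x Y W)" "linear (schouten G x Y)"
proof -
  have scale: "linear (\<lambda>X. c * f X)" if "linear f" for c and f :: "real^'n \<Rightarrow> real"
    using linear_compose_scale_right[OF that, of c] by simp
  show "linear (\<lambda>Y. schouten G x Y W)" "linear (schouten G x Y)"
    unfolding schouten_def[abs_def] by (intro linear_compose_sub scale Ric_linear metric_at_linear)+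
qed

lemma pairwise_alternating_schouten:
  "pairwise_alternating (kulkarni_nomizu (schouten G x) (metric_at G x))"
  by (intro pairwise_alternating_kulkarni_nomizu schouten_linear metric_at_linear)

lemma pairwise_alternating_weyl: "pairwise_alternating (weyl G x)"
  unfolding weyl_def[abs_def]
  by (rule pairwise_alternating_diff[OF pairwise_alternating_Rm pairwise_alternating_schouten])

end

end

section \<open>The Ricci eigenframe\<close>

theorem theorem1p1:
  fixes M :: "'m topology"
    and A :: "('m, 'n::finite) chart set"
    and g :: "('m, 'n) chart \<Rightarrow> real^'n \<Rightarrow> real^'n^'n"
    and U :: "'m set" and \<phi> :: "'m \<Rightarrow> real^'n" and p :: 'm
    and n :: nat
    and G :: "real^'n \<Rightarrow> real^'n^'n" and x :: "real^'n"
    and e :: "nat \<Rightarrow> real^'n" and lam :: "nat \<Rightarrow> real"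
    and lam2 :: "nat \<Rightarrow> nat \<Rightarrow> real" and W :: "nat \<Rightarrow> nat \<Rightarrow> nat \<Rightarrow> nat \<Rightarrow> real"
  assumes "compact_riemannian_manifold M A g"
    and "n = CARD('n)" and "n \<ge> 4"
    and "p \<in> topspace M"
    and "(U, \<phi>) \<in> A" and "p \<in> U"
    and "G = g (U, \<phi>)" and "x = \<phi> p"
    and "orthonormal_frame G x e"
    and "\<forall>i\<in>{1..n}. \<forall>Y. Ric G x (e i) Y = lam i * metric_at G x (e i) Y"
    and "\<forall>i j. lam2 i j = 1 / (real n - 2) * (lam i + lam j - 1 / (real n - 1) * scal G x)"
    and "\<forall>i j k l. W i j k l = weyl G x (e i) (e j) (e k) (e l)"
  shows
    "(\<forall>i j. 1 \<le> i \<and> i < j \<and> j \<le> n \<longrightarrow>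
        bivector_metric G x (curvature_op G x (wedge (e i) (e j))) (wedge (e i) (e j)) = lam2 i j + W i j i j \<and>
        lam2 i j + W i j i j = Rm G x (e i) (e j) (e i) (e j)) \<and>
     (\<forall>i j k l. 1 \<le> i \<and> i < j \<and> j \<le> n \<and> 1 \<le> k \<and> k < l \<and> l \<le> n \<and> (i, j) \<noteq> (k, l) \<longrightarrow>
        bivector_metric G x (curvature_op G x (wedge (e i) (e j))) (wedge (e k) (e l)) = W i j k l) \<and>
     curvature_op G x = (\<lambda>\<omega>. schouten_op G x \<omega> + weyl_op G x \<omega>) \<and>
     has_matrix_in_basis (schouten_op G x) {(i, j). 1 \<le> i \<and> i < j \<and> j \<le> n} (\<lambda>(i, j). wedge (e i) (e j))
        (\<lambda>(i, j) (k, l). if (i, j) = (k, l) then lam2 i j else 0) \<and>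
     has_matrix_in_basis (weyl_op G x) {(i, j). 1 \<le> i \<and> i < j \<and> j \<le> n} (\<lambda>(i, j). wedge (e i) (e j))
        (\<lambda>(i, j) (k, l). W i j k l)"
proof -
  let ?D = "\<phi> ` U" and ?S = "kulkarni_nomizu (schouten G x) (metric_at G x)"
  have riem: "riemannian_metric A g" and "is_chart M (U, \<phi>)"
    using assms(1,5) unfolding compact_riemannian_manifold_def smooth_manifold_def by blast+
  then have "open ?D" by (simp add: is_chart_def)
  have x: "x \<in> ?D" using assms(6,8) by blast
  interpret metric_on_open G ?D
  proof
    show "open ?D" by fact
    have "smooth_on (snd (U, \<phi>) ` fst (U, \<phi>)) (g (U, \<phi>))"
      using riem assms(5) unfolding riemannian_metric_def by blast
    then show "smooth_on ?D G" by (simp add: assms(7))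
    have "\<forall>y\<in>snd (U, \<phi>) ` fst (U, \<phi>). transpose (g (U, \<phi>) y) = g (U, \<phi>) y \<and>
        (\<forall>X. X \<noteq> 0 \<longrightarrow> X \<bullet> (g (U, \<phi>) y *v X) > 0)"
      using riem assms(5) unfolding riemannian_metric_def by blast
    then show "transpose (G y) = G y" "X \<noteq> 0 \<Longrightarrow> X \<bullet> (G y *v X) > 0" if "y \<in> ?D" for y X
      using that by (auto simp: assms(7))
  qed
  interpret frame_at G x e n
    by unfold_locales (use assms G_sym[OF x] in auto)
  note alternating = pairwise_alternating_Rm[OF x] pairwise_alternating_schouten[OF x]
    pairwise_alternating_weyl[OF x]
  \<comment> \<open>The eigenvalue of the Schouten tensor on \<open>e i\<close>; the scalar
    curvature term is split evenly so that \<open>s i + s j\<close> is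
    \<open>lam2 i j\<close>.\<close>
  define s where "s i = 1 / (real n - 2) * (lam i - scal G x / (2 * (real n - 1)))" for i
  have schouten_frame: "schouten G x (e i) (e j) = (if i = j then s i else 0)"
    if "i \<in> {1..n}" "j \<in> {1..n}" for i j
    using that metric_frame[OF that] assms(2,10) by (simp add: schouten_def s_def)
  have lam2: "lam2 i j = s i + s j" for i j
  proof -
    have "1 / (real n - 1) * scal G x = 2 * (scal G x / (2 * (real n - 1)))"
      using assms(3) by (simp add: divide_simps)
    then show ?thesis
      by (simp only: s_def assms(11) distrib_left[symmetric]) simp
  qed
  \<comment> \<open>The two positive terms of the product survive only for equal pairs. The negative
    ones would require \<open>i = l\<close> and \<open>j = k\<close>, impossible for increasing
    pairs.\<close>
  have S: "?S (e i) (e j) (e k) (e l) = (if (i, j) = (k, l) then lam2 i j else 0)"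
    if "(i, j) \<in> pairs" "(k, l) \<in> pairs" for i j k l
    using that by (auto simp: kulkarni_nomizu_def schouten_frame metric_frame lam2)
  have Rm: "Rm G x X Y Z V = ?S X Y Z V + weyl G x X Y Z V" for X Y Z V
    by (simp add: weyl_def)
  have curv: "bivector_metric G x (curvature_op G x (wedge X Y)) (wedge Z V) = Rm G x X Y Z V" for X Y Z V
    unfolding curvature_op_def by (rule bivector_operator_works(2)[OF alternating(1)])
  have Rm_frame: "Rm G x (e i) (e j) (e k) (e l) = (if (i, j) = (k, l) then lam2 i j else 0) + W i j k l"
    if "(i, j) \<in> pairs" "(k, l) \<in> pairs" for i j k l
    using S[OF that] Rm assms(12) by simp
  \<comment> \<open>The sum of the two operators satisfies the equation that characterises
    \<open>curvature_op\<close>, so uniqueness identifies them.\<close>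
  have sum: "curvature_op G x = (\<lambda>\<omega>. schouten_op G x \<omega> + weyl_op G x \<omega>)"
    unfolding curvature_op_def schouten_op_def weyl_op_def
    by (intro bivector_operator_eqI linear_compose_add bivector_operator_works alternating)
      (simp add: linear_add[OF bivector_metric_linear] bivector_operator_works(2) alternating Rm)
  \<comment> \<open>The matrix to be shown has \<open>W i j k l\<close> in row
    \<open>(i, j)\<close>, whereas the operator produces \<open>W k l i j\<close> there. The pair
    symmetry of \<open>Rm\<close> and of the diagonal part reconciles them.\<close>
  have W_sym: "W k l i j = W i j k l" if "(i, j) \<in> pairs" "(k, l) \<in> pairs" for i j k l
    using Rm_frame[OF that] Rm_frame[OF that(2,1)] Rm_pair_sym[OF x, of "e k" "e l" "e i" "e j"]
    by (auto split: if_splits)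
  have matrix_S: "has_matrix_in_basis (schouten_op G x) pairs frame_wedge
      (\<lambda>(i, j) (k, l). if (i, j) = (k, l) then lam2 i j else 0)"
    unfolding schouten_op_def
    by (rule bivector_operator_has_matrix[OF alternating(2)]) (use S in auto)
  have matrix_W: "has_matrix_in_basis (weyl_op G x) pairs frame_wedge (\<lambda>(i, j) (k, l). W i j k l)"
    unfolding weyl_op_def
    by (rule bivector_operator_has_matrix[OF alternating(3)]) (use W_sym assms(12) in auto)
  show ?thesis
    unfolding curv by (intro conjI sum matrix_S matrix_W) (auto simp: Rm_frame)
qed

end
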